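(* Let $K$ be a field, $S=K[x_1,\dots,x_n]$, and let $I\subset S$ be a Cohen-Macaulay monomial ideal of codimension $2$. Then $\mathcal{T}(I)$, each relation tree being identified with its set of edges, is the set of bases of a matroid.
   Context: An ideal $I\subset S$ is Cohen-Macaulay if $S/I$ is Cohen-Macaulay; its codimension is its height. Let $I$ be a Cohen-Macaulay monomial ideal of codimension $2$ with unique minimal set of monomial generators $u_1,\dots,u_{m+1}$ (in a fixed labelling). Let $U$ be the kernel of the map $\bigoplus_{i=1}^{m+1} Se_i\to S$, $e_i\mapsto u_i$; $U$ is a free $S$-module of rank $m$. For $i<j$ the Taylor relation is $r_{ij}=u_{ji}e_j-u_{ij}e_i\in U$, where $u_{ji}=u_i/\gcd(u_i,u_j)$ and $u_{ij}=u_j/\gcd(u_i,u_j)$. The Taylor relations generate $U$. A Hilbert-Burch matrix of $I$ is an $m\times(m+1)$ matrix whose rows are $m$ Taylor relations forming a minimal system of generators (equivalently a basis) of $U$. To such a matrix one assigns the graph on $[m+1]=\{1,\dots,m+1\}$ whose edges are the pairs $\{i,j\}$ for which $r_{ij}$ is a row of the matrix; this graph is a tree, called a relation tree of $I$. $\mathcal{T}(I)$ denotes the set of all relation trees of $I$. A collection $\mathcal{B}$ of subsets of a finite set $\mathcal{S}$ is the set of bases of a matroid if all $B\in\mathcal{B}$ have the same cardinality and for all $B_1,B_2\in\mathcal{B}$ and $i\in B_1\setminus B_2$ there exists $j\in B_2\setminus B_1$ such that $(B_1\setminus\{i\})\cup\{j\}\in\mathcal{B}$. Here $\mathcal{S}$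 is the set of all two-element subsets of $[m+1]$. *)

theory Defs
  imports
    "HOL-Library.Poly_Mapping"
    "HOL-Library.Extended_Nat"
    "HOL-Algebra.Algebra"
    "HOL-Algebra.Algebraic_Closure_Type"
begin

section \<open>Krull dimension, height and Cohen-Macaulay rings\<close>

definition prime_chain :: "('a, 'b) ring_scheme \<Rightarrow> nat \<Rightarrow> (nat \<Rightarrow> 'a set) \<Rightarrow> bool" where
  "prime_chain R l P \<longleftrightarrow> (\<forall>i\<le>l. primeideal (P i) R) \<and> (\<forall>i<l. P i \<subset> P (Suc i))"

definition krull_dim :: "('a, 'b) ring_scheme \<Rightarrow> enat" where
  "krull_dim R = Sup {enat l | l P. prime_chain R l P}"

definition prime_height :: "('a, 'b) ring_scheme \<Rightarrow> 'a set \<Rightarrow> enat" where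
  "prime_height R Q = Sup {enat l | l P. prime_chain R l P \<and> P l = Q}"

definition ideal_height :: "('a, 'b) ring_scheme \<Rightarrow> 'a set \<Rightarrow> enat" where
  "ideal_height R J = Inf {prime_height R Q | Q. primeideal Q R \<and> J \<subseteq> Q}"

definition regular_sequence :: "('a, 'b) ring_scheme \<Rightarrow> 'a list \<Rightarrow> bool" where
  "regular_sequence R xs \<longleftrightarrow>
     set xs \<subseteq> carrier R \<and>
     (\<forall>i<length xs. \<forall>a\<in>carrier R.
        xs ! i \<otimes>\<^bsub>R\<^esub> a \<in> Idl\<^bsub>R\<^esub> (set (take i xs)) \<longrightarrow> a \<in> Idl\<^bsub>R\<^esub> (set (take i xs))) \<and>
     Idl\<^bsub>R\<^esub> (set xs) \<noteq> carrier R"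

definition depth_in :: "('a, 'b) ring_scheme \<Rightarrow> 'a set \<Rightarrow> enat" where
  "depth_in R J = Sup {enat (length xs) | xs. regular_sequence R xs \<and> set xs \<subseteq> J}"

definition cohen_macaulay_local :: "('a, 'b) ring_scheme \<Rightarrow> bool" where
  "cohen_macaulay_local R \<longleftrightarrow>
     cring R \<and> noetherian_ring R \<and>
     (\<exists>J. (\<forall>J'. maximalideal J' R \<longleftrightarrow> J' = J) \<and> depth_in R J = krull_dim R)"

text \<open>The localization of a commutative ring at a prime ideal \<open>Q\<close>: the elements are the classes
  of pairs \<open>(a, s)\<close>, to be read as fractions \<open>a / s\<close>.\<close>

definition loc_rel :: "('a, 'b) ring_scheme \<Rightarrow> 'a set \<Rightarrow> (('a \<times> 'a) \<times> ('a \<times> 'a)) set" where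
  "loc_rel R Q = {((a, s), (b, t)).
     a \<in> carrier R \<and> b \<in> carrier R \<and> s \<in> carrier R - Q \<and> t \<in> carrier R - Q \<and>
     (\<exists>w\<in>carrier R - Q. w \<otimes>\<^bsub>R\<^esub> (t \<otimes>\<^bsub>R\<^esub> a) = w \<otimes>\<^bsub>R\<^esub> (s \<otimes>\<^bsub>R\<^esub> b))}"

definition loc_frac :: "('a, 'b) ring_scheme \<Rightarrow> 'a set \<Rightarrow> 'a \<Rightarrow> 'a \<Rightarrow> ('a \<times> 'a) set" where
  "loc_frac R Q a s = loc_rel R Q `` {(a, s)}"

definition localization :: "('a, 'b) ring_scheme \<Rightarrow> 'a set \<Rightarrow> ('a \<times> 'a) set ring" where
  "localization R Q = \<lparr>
     carrier = (carrier R \<times> (carrier R - Q)) // loc_rel R Q,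
     monoid.mult = (\<lambda>p q. \<Union>(a, s)\<in>p. \<Union>(b, t)\<in>q. loc_frac R Q (a \<otimes>\<^bsub>R\<^esub> b) (s \<otimes>\<^bsub>R\<^esub> t)),
     one = loc_frac R Q \<one>\<^bsub>R\<^esub> \<one>\<^bsub>R\<^esub>,
     ring.zero = loc_frac R Q \<zero>\<^bsub>R\<^esub> \<one>\<^bsub>R\<^esub>,
     add = (\<lambda>p q. \<Union>(a, s)\<in>p. \<Union>(b, t)\<in>q.
              loc_frac R Q (t \<otimes>\<^bsub>R\<^esub> a \<oplus>\<^bsub>R\<^esub> s \<otimes>\<^bsub>R\<^esub> b) (s \<otimes>\<^bsub>R\<^esub> t)) \<rparr>"

definition cohen_macaulay :: "('a, 'b) ring_scheme \<Rightarrow> bool" where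
  "cohen_macaulay R \<longleftrightarrow>
     cring R \<and> noetherian_ring R \<and>
     (\<forall>Q. maximalideal Q R \<longrightarrow> cohen_macaulay_local (localization R Q))"


section \<open>Polynomial rings and monomial ideals\<close>

text \<open>\<open>K[x\<^sub>1, \<dots>, x\<^sub>n]\<close> is the monoid algebra of the exponent vectors \<open>'n \<Rightarrow>\<^sub>0 nat\<close> over \<open>'k\<close>,
  with \<open>n = CARD('n)\<close>.\<close>

type_synonym 'n monom_exp = "'n \<Rightarrow>\<^sub>0 nat"
type_synonym ('n, 'k) mpoly = "'n monom_exp \<Rightarrow>\<^sub>0 'k"

abbreviation mpoly_ring :: "('n, 'k::field) mpoly ring" where
  "mpoly_ring \<equiv> ring_of_type_algebra"

definition monomial :: "'n monom_exp \<Rightarrow> ('n, 'k::field) mpoly" where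
  "monomial a = Poly_Mapping.single a 1"

text \<open>The exponent vector of the greatest common divisor of two monomials.\<close>

lift_definition exp_gcd :: "'n monom_exp \<Rightarrow> 'n monom_exp \<Rightarrow> 'n monom_exp"
  is "\<lambda>a b x. min (a x) (b x)"
proof -
  fix a b :: "'n \<Rightarrow> nat"
  assume "finite {x. a x \<noteq> 0}"
  then show "finite {x. min (a x) (b x) \<noteq> 0}"
    by (rule rev_finite_subset) auto
qed

definition monomial_ideal :: "('n, 'k::field) mpoly set \<Rightarrow> bool" where
  "monomial_ideal I \<longleftrightarrow> (\<exists>G. I = Idl\<^bsub>mpoly_ring\<^esub> (monomial ` G))"

definition minimal_monomial_generators ::
    "('n, 'k::field) mpoly set \<Rightarrow> 'n monom_exp set \<Rightarrow> bool" where
  "minimal_monomial_generators I G \<longleftrightarrow>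
     Idl\<^bsub>mpoly_ring\<^esub> (monomial ` G) = I \<and>
     (\<forall>H. H \<subset> G \<longrightarrow> Idl\<^bsub>mpoly_ring\<^esub> (monomial ` H) \<noteq> I)"


section \<open>Relation trees\<close>

text \<open>The free module \<open>\<Oplus>\<^sub>i S e\<^sub>i\<close> with basis indexed by \<open>{1..m+1}\<close> consists of the finitely
  supported families \<open>nat \<Rightarrow>\<^sub>0 S\<close> with support in \<open>{1..m+1}\<close>; \<open>e\<^sub>i\<close> is
  \<open>Poly_Mapping.single i 1\<close>.\<close>

definition fscale :: "'a::comm_ring_1 \<Rightarrow> (nat \<Rightarrow>\<^sub>0 'a) \<Rightarrow> (nat \<Rightarrow>\<^sub>0 'a)" where
  "fscale c = Poly_Mapping.map ((*) c)"

lemma lookup_fscale: "Poly_Mapping.lookup (fscale c v) i = c * Poly_Mapping.lookup v i"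
  by (simp add: fscale_def Poly_Mapping.map.rep_eq when_def)

global_interpretation free: Modules.module "fscale :: 'a::comm_ring_1 \<Rightarrow> _"
  defines free_span = free.span
  by unfold_locales
    (auto intro!: poly_mapping_eqI simp: lookup_fscale lookup_add algebra_simps)

text \<open>The \<open>i\<close>-th generator is \<open>monomial (u i)\<close>, for \<open>i \<in> {1..m+1}\<close>.\<close>

definition relation_module ::
    "nat \<Rightarrow> (nat \<Rightarrow> 'n monom_exp) \<Rightarrow> (nat \<Rightarrow>\<^sub>0 ('n, 'k::field) mpoly) set" where
  "relation_module m u =
     {v. Poly_Mapping.keys v \<subseteq> {1..m+1} \<and>
         (\<Sum>i\<in>{1..m+1}. Poly_Mapping.lookup v i * monomial (u i)) = 0}"

text \<open>\<open>r\<^sub>i\<^sub>j = u\<^sub>j\<^sub>i e\<^sub>j - u\<^sub>i\<^sub>j e\<^sub>i\<close> with \<open>u\<^sub>j\<^sub>i = u\<^sub>i / gcd(u\<^sub>i, u\<^sub>j)\<close> and \<open>u\<^sub>i\<^sub>j = u\<^sub>j / gcd(u\<^sub>i, u\<^sub>j)\<close>;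
  quotients of monomials are differences of exponent vectors.\<close>

definition taylor_relation ::
    "(nat \<Rightarrow> 'n monom_exp) \<Rightarrow> nat \<Rightarrow> nat \<Rightarrow> (nat \<Rightarrow>\<^sub>0 ('n, 'k::field) mpoly)" where
  "taylor_relation u i j =
     Poly_Mapping.single j (monomial (u i - exp_gcd (u i) (u j)))
     - Poly_Mapping.single i (monomial (u j - exp_gcd (u i) (u j)))"

text \<open>An \<open>m \<times> (m+1)\<close> matrix over \<open>S\<close> is given by its rows \<open>A 1, \<dots>, A m\<close>. Minimality of the
  system of generators means that no row can be omitted.\<close>

definition hilbert_burch_matrix ::
    "nat \<Rightarrow> (nat \<Rightarrow> 'n monom_exp) \<Rightarrow> (nat \<Rightarrow> (nat \<Rightarrow>\<^sub>0 ('n, 'k::field) mpoly)) \<Rightarrow> bool" where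
  "hilbert_burch_matrix m u A \<longleftrightarrow>
     (\<forall>k\<in>{1..m}. \<exists>i j. 1 \<le> i \<and> i < j \<and> j \<le> m + 1 \<and> A k = taylor_relation u i j) \<and>
     free_span (A ` {1..m}) = relation_module m u \<and>
     (\<forall>k\<in>{1..m}. free_span (A ` ({1..m} - {k})) \<noteq> relation_module m u)"

definition matrix_edges ::
    "nat \<Rightarrow> (nat \<Rightarrow> 'n monom_exp) \<Rightarrow> (nat \<Rightarrow> (nat \<Rightarrow>\<^sub>0 ('n, 'k::field) mpoly)) \<Rightarrow> nat set set" where
  "matrix_edges m u A =
     {{i, j} | i j. 1 \<le> i \<and> i < j \<and> j \<le> m + 1 \<and> (\<exists>k\<in>{1..m}. A k = taylor_relation u i j)}"

text \<open>The type argument provides the coefficient field. A relation tree is represented by its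
  edge set; its vertex set is always \<open>{1..m+1}\<close>.\<close>

definition relation_trees ::
    "'k::field itself \<Rightarrow> nat \<Rightarrow> (nat \<Rightarrow> 'n monom_exp) \<Rightarrow> nat set set set" where
  "relation_trees _ m u =
     {matrix_edges m u A | A :: nat \<Rightarrow> (nat \<Rightarrow>\<^sub>0 ('n, 'k) mpoly). hilbert_burch_matrix m u A}"


section \<open>Matroid bases\<close>

definition matroid_bases :: "'a set \<Rightarrow> 'a set set \<Rightarrow> bool" where
  "matroid_bases E \<B> \<longleftrightarrow>
     finite E \<and> (\<forall>B\<in>\<B>. B \<subseteq> E) \<and>
     (\<forall>B1\<in>\<B>. \<forall>B2\<in>\<B>. card B1 = card B2) \<and>
     (\<forall>B1\<in>\<B>. \<forall>B2\<in>\<B>. \<forall>i\<in>B1 - B2. \<exists>j\<in>B2 - B1. (B1 - {i}) \<union> {j} \<in> \<B>)"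

end

theory Submission
  imports Defs
begin

text \<open>
  The exchange property holds because, for the Taylor relations, \<open>S\<close> behaves like a local ring with
  residue map \<open>p \<mapsto> p(0)\<close>, the constant coefficient. Over a local ring, Nakayama's lemma turns the
  minimal generating subsets of a finite family in a module \<open>U\<close> into the bases that this family
  contains in the vector space \<open>U / \<mm> U\<close>, and Steinitz exchange applies.

  In place of units, the argument uses one consequence of locality, called saturation here:
  if \<open>p(0) \<noteq> 0\<close> and \<open>p \<cdot> r\<^sub>i\<^sub>j\<close> is an \<open>S\<close>-linear combination of Taylor relations
  \<open>r\<^sub>k\<^sub>l\<close>, then so is \<open>r\<^sub>i\<^sub>j\<close>, of the same ones. It holds by the multigrading of the free module in
  which \<open>e\<^sub>i\<close> has the degree of \<open>u\<^sub>i\<close>: the relation \<open>r\<^sub>i\<^sub>j\<close> is homogeneous, of degree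
  \<open>lcm(u\<^sub>i, u\<^sub>j)\<close>, and the component of \<open>p \<cdot> r\<^sub>i\<^sub>j\<close> in this degree is \<open>p(0) \<cdot> r\<^sub>i\<^sub>j\<close>, while a span of
  homogeneous elements contains the components of its members
  (\<open>multihomogeneous_saturated\<close>). Lemma \<open>minimally_generates_exchange\<close> derives the exchange
  property from saturation alone.

  A relation tree is the edge set of a minimal generating family with \<open>m\<close> members, and an edge can
  be recovered from its Taylor relation (\<open>relation_trees_iff\<close>). So all relation trees have
  \<open>m\<close> edges, and the exchange carries over to edge sets.
\<close>

section \<open>Exchange between minimal generating families\<close>

text \<open>Families indexed by sets, rather than sets of module elements, let the index be an edge.
  The span operator is a parameter so that the notion serves both the abstract module
  and the free module over the polynomial ring.\<close>

definition minimally_generates ::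
    "('b set \<Rightarrow> 'b set) \<Rightarrow> ('i \<Rightarrow> 'b) \<Rightarrow> 'i set \<Rightarrow> 'b set \<Rightarrow> bool" where
  "minimally_generates sp r B U \<longleftrightarrow>
     sp (r ` B) = U \<and> (\<forall>e\<in>B. sp (r ` (B - {e})) \<noteq> U)"

text \<open>The abstract form of the local behaviour: scalars outside the kernel of the ring homomorphism
  \<open>\<phi>\<close> act on the members of the family as units would, as far as membership in spans of
  subfamilies is concerned.\<close>

locale saturated_family = Modules.module scale
  for scale :: "'a::comm_ring_1 \<Rightarrow> 'b::ab_group_add \<Rightarrow> 'b" +
  fixes \<phi> :: "'a \<Rightarrow> 'f::idom" and r :: "'i \<Rightarrow> 'b" and T :: "'i set"
  assumes \<phi>_add: "\<phi> (x + y) = \<phi> x + \<phi> y"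
    and \<phi>_mult: "\<phi> (x * y) = \<phi> x * \<phi> y"
    and \<phi>_one: "\<phi> 1 = 1"
    and saturated: "\<lbrakk>Y \<subseteq> T; e \<in> T; \<phi> c \<noteq> 0; scale c (r e) \<in> span (r ` Y)\<rbrakk>
      \<Longrightarrow> r e \<in> span (r ` Y)"
begin

lemma minimally_generates_not_in_span:
  assumes "minimally_generates span r B U" "e \<in> B"
  shows "r e \<notin> span (r ` (B - {e}))"
proof
  assume "r e \<in> span (r ` (B - {e}))"
  then have "span (insert (r e) (r ` (B - {e}))) = span (r ` (B - {e}))"
    by (intro subset_antisym span_minimal span_mono)
      (auto intro: span_base)
  moreover have "insert (r e) (r ` (B - {e})) = r ` B"
    using assms(2) by blast
  ultimately show False
    using assms unfolding minimally_generates_def by metis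
qed

lemma span_image_remove:
  assumes "e \<in> B" "v \<in> span (r ` B)"
  obtains c n where "v = scale c (r e) + n" "n \<in> span (r ` (B - {e}))"
proof -
  have "v \<in> span (insert (r e) (r ` (B - {e})))"
    using assms by (metis image_insert insert_Diff)
  then obtain c where "v - scale c (r e) \<in> span (r ` (B - {e}))"
    unfolding span_insert by blast
  then show ?thesis
    by (intro that[of c "v - scale c (r e)"]) simp_all
qed

text \<open>
  Every \<open>r f\<close> with \<open>f \<in> B2\<close> has the form \<open>c \<cdot> r e + n\<close> with \<open>n\<close> in the span \<open>N\<close> of the other
  members of \<open>B1\<close>. If \<open>c\<close> could always be taken in the kernel of \<open>\<phi>\<close>, then \<open>r e\<close> itself would
  have such a form, so \<open>(1 - c) \<cdot> r e \<in> N\<close>, and saturation would make \<open>e\<close> redundant in \<open>B1\<close>.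
  Hence for some \<open>f\<close> the coefficient is outside the kernel, and \<open>r f\<close> can replace \<open>r e\<close>.
\<close>

lemma minimally_generates_exchange:
  assumes B1: "minimally_generates span r B1 U" "B1 \<subseteq> T"
    and B2: "minimally_generates span r B2 U" "B2 \<subseteq> T"
    and e: "e \<in> B1 - B2"
  shows "\<exists>f\<in>B2 - B1. minimally_generates span r ((B1 - {e}) \<union> {f}) U"
proof -
  define N where "N = span (r ` (B1 - {e}))"
  have zero: "\<phi> 0 = 0"
    using \<phi>_add[of 0 0] by (metis add.right_neutral add_cancel_right_right)
  have one_minus: "\<phi> (1 - x) = 1" if "\<phi> x = 0" for x
    using \<phi>_add[of "1 - x" x] \<phi>_one that by simp
  have U1: "span (r ` B1) = U" and U2: "span (r ` B2) = U"
    using B1 B2 unfolding minimally_generates_def by auto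
  have eN: "\<phi> c = 0" if "scale c (r e) \<in> N" for c
    using saturated[of "B1 - {e}" e c] minimally_generates_not_in_span[OF B1(1), of e] e B1(2) that
    unfolding N_def by blast
  \<comment> \<open>Coefficients need not be unique, so \<open>f\<close> is chosen to admit no coefficient in the kernel at all.\<close>
  have "\<exists>f\<in>B2. \<not> (\<exists>c n. \<phi> c = 0 \<and> n \<in> N \<and> r f = scale c (r e) + n)"
  proof (rule ccontr)
    assume none: "\<not> ?thesis"
    define V where "V = {v. \<exists>c n. \<phi> c = 0 \<and> n \<in> N \<and> v = scale c (r e) + n}"
    have "subspace V"
    proof (rule subspaceI)
      have "0 \<in> N"
        by (simp add: N_def span_zero)
      then show "0 \<in> V"
        unfolding V_def using zero by (intro CollectI exI[of _ 0]) auto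
    next
      fix x y assume "x \<in> V" "y \<in> V"
      then obtain c n c' n' where x: "\<phi> c = 0" "n \<in> N" "x = scale c (r e) + n"
        and y: "\<phi> c' = 0" "n' \<in> N" "y = scale c' (r e) + n'"
        unfolding V_def by blast
      have "x + y = scale (c + c') (r e) + (n + n')"
        by (simp add: x y scale_left_distrib algebra_simps)
      moreover have "n + n' \<in> N"
        using x y by (simp add: N_def span_add)
      ultimately show "x + y \<in> V"
        unfolding V_def using x y \<phi>_add by (metis (mono_tags, lifting) CollectI add_0)
    next
      fix q x assume "x \<in> V"
      then obtain c n where x: "\<phi> c = 0" "n \<in> N" "x = scale c (r e) + n"
        unfolding V_def by blast
      have "scale q x = scale (q * c) (r e) + scale q n"
        by (simp add: x scale_right_distrib)
      moreover have "scale q n \<in> N"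
        using x by (simp add: N_def span_scale)
      ultimately show "scale q x \<in> V"
        unfolding V_def using x \<phi>_mult by (metis (mono_tags, lifting) CollectI mult_zero_right)
    qed
    moreover have "r ` B2 \<subseteq> V"
      using none unfolding V_def by blast
    ultimately have "U \<subseteq> V"
      using U2 span_minimal by blast
    moreover have "r e \<in> U"
      using e U1 by (metis DiffD1 imageI span_base)
    ultimately obtain c n where c: "\<phi> c = 0" "n \<in> N" "r e = scale c (r e) + n"
      unfolding V_def by blast
    have "scale (1 - c) (r e) = r e - scale c (r e)"
      by (simp add: scale_left_diff_distrib)
    also have "\<dots> = n"
      using c(3) by (metis add_diff_cancel_left')
    finally have "\<phi> (1 - c) = 0"
      using eN c(2) by simp
    then show False
      using one_minus[OF c(1)] by simp
  qed
  then obtain f where f: "f \<in> B2"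
    and no: "\<And>c n. \<lbrakk>n \<in> N; r f = scale c (r e) + n\<rbrakk> \<Longrightarrow> \<phi> c \<noteq> 0"
    by blast
  have rfU: "r f \<in> span (r ` B1)"
    using f U1 U2 by (metis imageI span_base)
  obtain c n where n: "n \<in> N" and rf: "r f = scale c (r e) + n"
    using span_image_remove[OF _ rfU, of e] e unfolding N_def by blast
  have c: "\<phi> c \<noteq> 0"
    using no n rf by blast
  have cre: "scale c (r e) = r f - n"
    by (simp add: rf)
  have "f \<notin> B1"
  proof
    assume "f \<in> B1"
    with e f have "r f \<in> N"
      unfolding N_def by (intro span_base) auto
    then have "scale c (r e) \<in> N"
      unfolding cre using n by (simp add: N_def span_diff)
    then show False
      using eN c by blast
  qed
  let ?B = "(B1 - {e}) \<union> {f}"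
  have sub: "r ` ?B \<subseteq> U"
    using f span_superset[of "r ` B1"] span_superset[of "r ` B2"] unfolding U1 U2 by auto
  have "N \<subseteq> span (r ` ?B)"
    unfolding N_def by (intro span_mono) auto
  moreover have "r f \<in> span (r ` ?B)"
    by (intro span_base) auto
  ultimately have "scale c (r e) \<in> span (r ` ?B)"
    unfolding cre using n by (intro span_diff) auto
  then have re: "r e \<in> span (r ` ?B)"
    using saturated[of ?B e c] c e f B1(2) B2(2) by blast
  have "span (r ` ?B) = U"
  proof
    show "span (r ` ?B) \<subseteq> U"
      using sub U1 subspace_span span_minimal by metis
    have "r ` B1 \<subseteq> span (r ` ?B)"
      using re by (auto intro: span_base)
    then show "U \<subseteq> span (r ` ?B)"
      using U1 subspace_span span_minimal by metis
  qed
  moreover have "span (r ` (?B - {g})) \<noteq> U" if g: "g \<in> ?B" for g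
  proof (cases "g = f")
    case True
    then have "?B - {g} = B1 - {e}"
      using \<open>f \<notin> B1\<close> by auto
    then show ?thesis
      using B1 e unfolding minimally_generates_def by auto
  next
    case False
    then have g: "g \<in> B1" "g \<noteq> e"
      using g by auto
    show ?thesis
    proof
      assume gen: "span (r ` (?B - {g})) = U"
      have "r g \<in> span (r ` (?B - {g}))"
        unfolding gen using g U1 by (metis imageI span_base)
      \<comment> \<open>If \<open>g\<close> were redundant after the exchange, \<open>r g\<close> would need \<open>r f\<close> with some coefficient
        \<open>h\<close>. Eliminating \<open>r f\<close> makes \<open>e\<close> redundant in \<open>B1\<close> when \<open>\<phi> h \<noteq> 0\<close>, and \<open>g\<close> redundant
        in \<open>B1\<close> otherwise.\<close>
      then obtain h k where h: "r g = scale h (r f) + k" "k \<in> span (r ` (?B - {g} - {f}))"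
        using span_image_remove[of f "?B - {g}" "r g"] False by blast
      have k: "k \<in> span (r ` (B1 - {e} - {g}))"
        by (rule subsetD[OF span_mono h(2)]) auto
      have "n \<in> span (r ` (B1 - {e}))"
        using n by (simp add: N_def)
      then obtain c' l where l: "n = scale c' (r g) + l" "l \<in> span (r ` (B1 - {e} - {g}))"
        using span_image_remove[of g "B1 - {e}" n] g by blast
      show False
      proof (cases "\<phi> h = 0")
        case False
        have "scale (h * c) (r e) = r g - k - scale h n"
          by (simp add: h(1) rf scale_right_distrib)
        moreover have "k \<in> N"
          unfolding N_def by (rule subsetD[OF span_mono k]) auto
        moreover have "r g \<in> N"
          unfolding N_def using g by (intro span_base) auto
        ultimately have "scale (h * c) (r e) \<in> N"
          using n by (simp add: N_def span_diff span_scale)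
        then show False
          using eN[of "h * c"] False c \<phi>_mult by auto
      next
        case True
        have "scale h (r f) = scale (h * c) (r e) + scale (h * c') (r g) + scale h l"
          unfolding rf l(1) by (simp add: scale_right_distrib add.assoc)
        then have "r g - scale (h * c') (r g) = scale (h * c) (r e) + scale h l + k"
          by (subst h(1)) simp
        then have "scale (1 - h * c') (r g) = scale (h * c) (r e) + scale h l + k"
          by (simp add: scale_left_diff_distrib)
        moreover have "r e \<in> span (r ` (B1 - {g}))"
          using e g by (intro span_base) auto
        moreover have "k \<in> span (r ` (B1 - {g}))" "l \<in> span (r ` (B1 - {g}))"
          by (rule subsetD[OF span_mono k], auto) (rule subsetD[OF span_mono l(2)], auto)
        ultimately have "scale (1 - h * c') (r g) \<in> span (r ` (B1 - {g}))"
          by (simp add: span_add span_scale)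
        moreover have "\<phi> (1 - h * c') = 1"
          by (rule one_minus) (simp add: \<phi>_mult True)
        ultimately have "r g \<in> span (r ` (B1 - {g}))"
          by (intro saturated[of "B1 - {g}" g "1 - h * c'"]) (use g B1(2) in auto)
        then show False
          using minimally_generates_not_in_span[OF B1(1) g(1)] by blast
      qed
    qed
  qed
  ultimately have "minimally_generates span r ?B U"
    unfolding minimally_generates_def by blast
  then show ?thesis
    using f \<open>f \<notin> B1\<close> by blast
qed

end

section \<open>Multigraded components\<close>

lemma lookup_times_single:
  fixes p :: "('n, 'k::field) mpoly"
  shows "Poly_Mapping.lookup (p * Poly_Mapping.single d c) a
    = (\<Sum>l. Poly_Mapping.lookup p l * c when a = l + d)"
proof -
  have inner: "(\<Sum>q. Poly_Mapping.lookup (Poly_Mapping.single d c) q when a = l + q) = (c when a = l + d)"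
    for l
  proof -
    have "(\<Sum>q. Poly_Mapping.lookup (Poly_Mapping.single d c) q when a = l + q)
        = (\<Sum>q. (c when a = l + q) when q = d)"
      by (intro arg_cong[of _ _ Sum_any] ext) (auto simp: lookup_single when_def)
    then show ?thesis
      by simp
  qed
  show ?thesis
    unfolding lookup_mult inner by (simp add: mult_when)
qed

lemma lookup_times_single_add:
  fixes p :: "('n, 'k::field) mpoly"
  shows "Poly_Mapping.lookup (p * Poly_Mapping.single d c) (b + d) = Poly_Mapping.lookup p b * c"
proof -
  have "(\<Sum>l. Poly_Mapping.lookup p l * c when b + d = l + d)
      = (\<Sum>l. Poly_Mapping.lookup p l * c when l = b)"
    by (intro arg_cong[of _ _ Sum_any] ext) (auto simp: when_def)
  then show ?thesis
    by (simp add: lookup_times_single)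
qed

lemma times_monomial_cancel:
  fixes p q :: "('n, 'k::field) mpoly"
  assumes "p * monomial d = q * monomial d"
  shows "p = q"
proof (rule poly_mapping_eqI)
  fix b
  show "Poly_Mapping.lookup p b = Poly_Mapping.lookup q b"
    using arg_cong[OF assms, of "\<lambda>x. Poly_Mapping.lookup x (b + d)"]
    by (simp add: monomial_def lookup_times_single_add)
qed

text \<open>Exponents are natural numbers, so only \<open>0 + 0\<close> contributes to the exponent \<open>0\<close>.\<close>

lemma lookup_mult_zero:
  fixes p q :: "('n, 'k::field) mpoly"
  shows "Poly_Mapping.lookup (p * q) 0 = Poly_Mapping.lookup p 0 * Poly_Mapping.lookup q 0"
proof -
  have sum_zero: "(0 = l + b) = (b = 0 \<and> l = 0)" for l b :: "'n monom_exp"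
  proof
    assume "0 = l + b"
    then have "Poly_Mapping.lookup l x + Poly_Mapping.lookup b x = 0" for x
      by (metis lookup_add lookup_zero)
    then show "b = 0 \<and> l = 0"
      by (auto intro!: poly_mapping_eqI)
  qed simp
  have "(\<Sum>b. Poly_Mapping.lookup q b when 0 = l + b) = (Poly_Mapping.lookup q 0 when l = 0)" for l
  proof -
    have "(\<Sum>b. Poly_Mapping.lookup q b when 0 = l + b)
        = (\<Sum>b. (Poly_Mapping.lookup q b when l = 0) when b = 0)"
      by (intro arg_cong[of _ _ Sum_any] ext) (auto simp: when_def sum_zero)
    then show ?thesis
      by simp
  qed
  then show ?thesis
    by (simp add: lookup_mult mult_when)
qed

text \<open>Only the term of \<open>q\<close> with exponent \<open>a - d\<close> contributes to the degree \<open>a\<close> part of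
  \<open>q \<cdot> x\<^sup>d\<close>. Subtraction of exponent vectors truncates, so the case in which \<open>x\<^sup>d\<close> does not
  divide \<open>x\<^sup>a\<close> has to be separated.\<close>

definition component_quotient ::
    "'n monom_exp \<Rightarrow> 'n monom_exp \<Rightarrow> ('n, 'k::field) mpoly \<Rightarrow> ('n, 'k) mpoly" where
  "component_quotient a d q =
     (if \<exists>b. a = b + d then Poly_Mapping.single (a - d) (Poly_Mapping.lookup q (a - d)) else 0)"

lemma component_quotient_times_single:
  "component_quotient a d q * Poly_Mapping.single d c
     = Poly_Mapping.single a (Poly_Mapping.lookup (q * Poly_Mapping.single d c) a)"
proof (cases "\<exists>b. a = b + d")
  case True
  then show ?thesis
    by (auto simp: component_quotient_def mult_single lookup_times_single_add)
next
  case False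
  then have "Poly_Mapping.lookup (q * Poly_Mapping.single d c) a = 0"
    by (simp add: lookup_times_single when_def)
  with False show ?thesis
    by (simp add: component_quotient_def)
qed

text \<open>Multiplying the \<open>i\<close>-th entry by \<open>u\<^sub>i\<close> embeds the free module into itself and turns the grading
  with \<open>deg e\<^sub>i = u\<^sub>i\<close> into the grading of each entry by its exponents. Homogeneous elements are
  described after this embedding, which avoids dividing degrees by \<open>u\<^sub>i\<close>.\<close>

definition multihomogeneous ::
    "(nat \<Rightarrow> 'n monom_exp) \<Rightarrow> 'n monom_exp \<Rightarrow> (nat \<Rightarrow>\<^sub>0 ('n, 'k::field) mpoly) \<Rightarrow> bool" where
  "multihomogeneous u d v \<longleftrightarrow>
     (\<exists>\<gamma>. \<forall>i. Poly_Mapping.lookup v i * monomial (u i) = Poly_Mapping.single d (\<gamma> i))"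

text \<open>In a linear combination of homogeneous elements, the part of degree \<open>a\<close> arises by replacing
  each coefficient by its single term of the degree that remains.\<close>

lemma component_in_span:
  fixes Y :: "(nat \<Rightarrow>\<^sub>0 ('n, 'k::field) mpoly) set"
  assumes Y: "\<And>x. x \<in> Y \<Longrightarrow> \<exists>d. multihomogeneous u d x"
    and v: "v \<in> free_span Y"
  shows "\<exists>w\<in>free_span Y. \<forall>i. Poly_Mapping.lookup w i * monomial (u i)
    = Poly_Mapping.single a (Poly_Mapping.lookup (Poly_Mapping.lookup v i * monomial (u i)) a)"
  using v
proof (induction rule: free.span_induct_alt)
  case base
  show ?case
    by (rule bexI[OF _ free.span_zero]) simp
next
  case (step c x y)
  obtain d \<gamma> where x: "\<And>i. Poly_Mapping.lookup x i * monomial (u i) = Poly_Mapping.single d (\<gamma> i)"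
    using Y[OF step(1)] unfolding multihomogeneous_def by blast
  obtain w where w: "w \<in> free_span Y" "\<And>i. Poly_Mapping.lookup w i * monomial (u i)
    = Poly_Mapping.single a (Poly_Mapping.lookup (Poly_Mapping.lookup y i * monomial (u i)) a)"
    using step(2) by blast
  have "fscale (component_quotient a d c) x + w \<in> free_span Y"
    by (rule free.span_add[OF free.span_scale[OF free.span_base[OF step(1)]] w(1)])
  moreover have "Poly_Mapping.lookup (fscale (component_quotient a d c) x + w) i * monomial (u i)
    = Poly_Mapping.single a (Poly_Mapping.lookup (Poly_Mapping.lookup (fscale c x + y) i * monomial (u i)) a)"
    for i
    by (simp add: lookup_add lookup_fscale distrib_right mult.assoc x w(2)
        component_quotient_times_single single_add)
  ultimately show ?case
    by blast
qed

text \<open>The component of \<open>p \<cdot> v\<close> in the degree of \<open>v\<close> is \<open>p(0) \<cdot> v\<close>, and \<open>p(0)\<close> is invertible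
  in the field.\<close>

lemma multihomogeneous_saturated:
  fixes Y :: "(nat \<Rightarrow>\<^sub>0 ('n, 'k::field) mpoly) set"
  assumes Y: "\<And>x. x \<in> Y \<Longrightarrow> \<exists>d. multihomogeneous u d x"
    and v: "multihomogeneous u d v"
    and p: "Poly_Mapping.lookup p 0 \<noteq> 0" "fscale p v \<in> free_span Y"
  shows "v \<in> free_span Y"
proof -
  obtain \<gamma> where \<gamma>: "\<And>i. Poly_Mapping.lookup v i * monomial (u i) = Poly_Mapping.single d (\<gamma> i)"
    using v unfolding multihomogeneous_def by blast
  obtain w where w: "w \<in> free_span Y" "\<And>i. Poly_Mapping.lookup w i * monomial (u i)
    = Poly_Mapping.single d (Poly_Mapping.lookup (Poly_Mapping.lookup (fscale p v) i * monomial (u i)) d)"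
    using component_in_span[OF Y p(2), of d] by blast
  let ?c = "Poly_Mapping.lookup p 0"
  have "Poly_Mapping.lookup v i = Poly_Mapping.lookup (fscale (Poly_Mapping.single 0 (1 / ?c)) w) i" for i
  proof (rule times_monomial_cancel[of _ "u i"])
    have "Poly_Mapping.lookup (p * Poly_Mapping.single d (\<gamma> i)) d = ?c * \<gamma> i"
      using lookup_times_single_add[of p d "\<gamma> i" 0] by simp
    then show "Poly_Mapping.lookup v i * monomial (u i)
      = Poly_Mapping.lookup (fscale (Poly_Mapping.single 0 (1 / ?c)) w) i * monomial (u i)"
      using p(1) by (simp add: lookup_fscale mult.assoc w(2) \<gamma> mult_single)
  qed
  then have "v = fscale (Poly_Mapping.single 0 (1 / ?c)) w"
    by (rule poly_mapping_eqI)
  then show ?thesis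
    using w(1) free.span_scale by metis
qed

text \<open>The degree is \<open>lcm(u\<^sub>i, u\<^sub>j) = (u\<^sub>i / gcd(u\<^sub>i, u\<^sub>j)) \<cdot> u\<^sub>j\<close>.\<close>

lemma taylor_relation_multihomogeneous:
  assumes "i \<noteq> j"
  shows "\<exists>d. multihomogeneous u d (taylor_relation u i j :: nat \<Rightarrow>\<^sub>0 ('n, 'k::field) mpoly)"
proof -
  let ?g = "exp_gcd (u i) (u j)"
  define d where "d = u i - ?g + u j"
  have d': "u j - ?g + u i = d"
    unfolding d_def
    by (rule poly_mapping_eqI) (auto simp: lookup_add lookup_minus exp_gcd.rep_eq)
  let ?\<gamma> = "\<lambda>k. if k = j then 1 else if k = i then -1 else (0::'k)"
  have "Poly_Mapping.lookup (taylor_relation u i j) k * monomial (u k) = Poly_Mapping.single d (?\<gamma> k)" for k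
    using assms d'
    by (auto simp: taylor_relation_def lookup_minus lookup_single monomial_def mult_single
        d_def single_uminus)
  then show ?thesis
    unfolding multihomogeneous_def by (intro exI[of _ d] exI[of _ ?\<gamma>]) blast
qed

section \<open>Relation trees as edge sets\<close>

definition edge_relation :: "(nat \<Rightarrow> 'n monom_exp) \<Rightarrow> nat set \<Rightarrow> (nat \<Rightarrow>\<^sub>0 ('n, 'k::field) mpoly)" where
  "edge_relation u e = taylor_relation u (Min e) (Max e)"

definition edges :: "nat \<Rightarrow> nat set set" where
  "edges m = {e. e \<subseteq> {1..m+1} \<and> card e = 2}"

lemma finite_edges: "finite (edges m)"
  by (rule finite_subset[of _ "Pow {1..m+1}"]) (auto simp: edges_def)

lemma edges_iff: "e \<in> edges m \<longleftrightarrow> (\<exists>i j. 1 \<le> i \<and> i < j \<and> j \<le> m + 1 \<and> e = {i, j})"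
proof
  assume "e \<in> edges m"
  then have e: "e \<subseteq> {1..m+1}" "card e = 2"
    by (auto simp: edges_def)
  then obtain x y where "e = {x, y}" "x \<noteq> y"
    by (auto simp: card_2_iff)
  with e show "\<exists>i j. 1 \<le> i \<and> i < j \<and> j \<le> m + 1 \<and> e = {i, j}"
    by (intro exI[of _ "min x y"] exI[of _ "max x y"]) (auto simp: min_def max_def)
qed (auto simp: edges_def)

lemma edge_relation_pair: "i < j \<Longrightarrow> edge_relation u {i, j} = taylor_relation u i j"
  by (simp add: edge_relation_def)

lemma keys_taylor_relation:
  assumes "i \<noteq> j"
  shows "Poly_Mapping.keys (taylor_relation u i j :: nat \<Rightarrow>\<^sub>0 ('n, 'k::field) mpoly) = {i, j}"
proof -
  have "(monomial a :: ('n, 'k) mpoly) \<noteq> 0" for a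
    by (metis lookup_single_eq lookup_zero monomial_def one_neq_zero)
  then show ?thesis
    using assms by (auto simp: in_keys_iff taylor_relation_def lookup_minus lookup_single when_def split: if_splits)
qed

text \<open>An edge is the support of its Taylor relation, which makes the passage from edges to
  relations injective.\<close>

lemma keys_edge_relation:
  assumes "e \<in> edges m"
  shows "Poly_Mapping.keys (edge_relation u e :: nat \<Rightarrow>\<^sub>0 ('n, 'k::field) mpoly) = e"
  using assms by (auto simp: edges_iff edge_relation_pair keys_taylor_relation)

lemma inj_on_edge_relation:
  "inj_on (edge_relation u :: nat set \<Rightarrow> nat \<Rightarrow>\<^sub>0 ('n, 'k::field) mpoly) (edges m)"
  by (metis inj_onI keys_edge_relation)

lemma matrix_edges_eq:
  fixes A :: "nat \<Rightarrow> (nat \<Rightarrow>\<^sub>0 ('n, 'k::field) mpoly)"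
  shows "matrix_edges m u A = {e \<in> edges m. edge_relation u e \<in> A ` {1..m}}"
proof
  show "matrix_edges m u A \<subseteq> {e \<in> edges m. edge_relation u e \<in> A ` {1..m}}"
  proof
    fix e assume "e \<in> matrix_edges m u A"
    then obtain i j k where "e = {i, j}" "1 \<le> i" "i < j" "j \<le> m + 1" "k \<in> {1..m}"
      "A k = taylor_relation u i j"
      unfolding matrix_edges_def by blast
    then show "e \<in> {e \<in> edges m. edge_relation u e \<in> A ` {1..m}}"
      by (metis (mono_tags, lifting) CollectI edge_relation_pair edges_iff image_eqI)
  qed
  show "{e \<in> edges m. edge_relation u e \<in> A ` {1..m}} \<subseteq> matrix_edges m u A"
  proof
    fix e assume e: "e \<in> {e \<in> edges m. edge_relation u e \<in> A ` {1..m}}"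
    then obtain i j where ij: "1 \<le> i" "i < j" "j \<le> m + 1" "e = {i, j}"
      unfolding edges_iff by blast
    moreover have "\<exists>k\<in>{1..m}. A k = taylor_relation u i j"
      using e ij by (auto simp: edge_relation_pair)
    ultimately show "e \<in> matrix_edges m u A"
      unfolding matrix_edges_def by blast
  qed
qed

text \<open>Minimality forces the rows of a Hilbert-Burch matrix to be distinct: a repeated row could be
  omitted. So the rows correspond bijectively to the edges of the tree, and numbering the edges
  of a minimal generating family gives back a matrix.\<close>

lemma relation_trees_iff:
  "E \<in> relation_trees TYPE('k::field) m u \<longleftrightarrow>
     E \<subseteq> edges m \<and> card E = m \<and>
     minimally_generates free_span (edge_relation u :: nat set \<Rightarrow> nat \<Rightarrow>\<^sub>0 ('n, 'k) mpoly) E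
       (relation_module m u)"
  (is "_ \<longleftrightarrow> _ \<and> _ \<and> minimally_generates free_span ?R E ?U")
proof
  assume "E \<in> relation_trees TYPE('k) m u"
  then obtain A :: "nat \<Rightarrow> (nat \<Rightarrow>\<^sub>0 ('n, 'k) mpoly)"
    where A: "hilbert_burch_matrix m u A" and E: "E = matrix_edges m u A"
    unfolding relation_trees_def by blast
  have EE: "E \<subseteq> edges m"
    unfolding E matrix_edges_eq by blast
  have inj: "inj_on ?R E"
    using inj_on_edge_relation EE by (rule inj_on_subset)
  have RE: "?R ` E = A ` {1..m}"
  proof
    show "?R ` E \<subseteq> A ` {1..m}"
      unfolding E matrix_edges_eq by blast
    show "A ` {1..m} \<subseteq> ?R ` E"
    proof
      fix x assume x: "x \<in> A ` {1..m}"
      then obtain i j where ij: "1 \<le> i" "i < j" "j \<le> m + 1" "x = taylor_relation u i j"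
        using A unfolding hilbert_burch_matrix_def by blast
      then have "{i, j} \<in> edges m" "x = ?R {i, j}"
        by (auto simp: edges_iff edge_relation_pair)
      with x show "x \<in> ?R ` E"
        unfolding E matrix_edges_eq by (intro image_eqI[of _ _ "{i, j}"]) simp_all
    qed
  qed
  have "inj_on A {1..m}"
  proof (rule inj_onI, rule ccontr)
    fix k l assume kl: "k \<in> {1..m}" "l \<in> {1..m}" "A k = A l" "k \<noteq> l"
    then have "A k \<in> A ` ({1..m} - {k})"
      by (metis DiffI imageI singletonD)
    then have "A ` ({1..m} - {k}) = A ` {1..m}"
      using kl(1) by blast
    then show False
      using A kl(1) unfolding hilbert_burch_matrix_def by metis
  qed
  then have "card E = m"
    using card_image[OF inj] card_image[of A "{1..m}"] by (simp add: RE)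
  moreover have "free_span (?R ` (E - {e})) \<noteq> ?U" if e: "e \<in> E" for e
  proof -
    obtain k where k: "k \<in> {1..m}" "?R e = A k"
      using RE e by blast
    have "?R ` (E - {e}) = ?R ` E - {?R e}"
      using inj_on_image_set_diff[OF inj, of E "{e}"] e by simp
    also have "\<dots> = A ` ({1..m} - {k})"
      using inj_on_image_set_diff[OF \<open>inj_on A {1..m}\<close>, of "{1..m}" "{k}"] k RE by simp
    finally show ?thesis
      using A k(1) unfolding hilbert_burch_matrix_def by simp
  qed
  ultimately show "E \<subseteq> edges m \<and> card E = m \<and> minimally_generates free_span ?R E ?U"
    using EE RE A unfolding minimally_generates_def hilbert_burch_matrix_def by simp
next
  assume E: "E \<subseteq> edges m \<and> card E = m \<and> minimally_generates free_span ?R E ?U"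
  then have "finite E"
    using finite_edges finite_subset by blast
  with E obtain h where h: "bij_betw h {1..m} E"
    using ex_bij_betw_nat_finite_1 by blast
  define A where "A = ?R \<circ> h"
  have img: "h ` {1..m} = E" and injh: "inj_on h {1..m}"
    using h by (auto simp: bij_betw_def)
  have imgA: "A ` Z = ?R ` (h ` Z)" for Z
    by (simp add: A_def image_comp)
  have "hilbert_burch_matrix m u A"
    unfolding hilbert_burch_matrix_def
  proof (intro conjI ballI)
    fix k assume k: "k \<in> {1..m}"
    then have "h k \<in> edges m"
      using E img by blast
    then obtain i j where ij: "1 \<le> i" "i < j" "j \<le> m + 1" "h k = {i, j}"
      unfolding edges_iff by blast
    then have "A k = taylor_relation u i j"
      by (simp add: A_def edge_relation_pair)
    with ij show "\<exists>i j. 1 \<le> i \<and> i < j \<and> j \<le> m + 1 \<and> A k = taylor_relation u i j"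
      by blast
    have "h ` ({1..m} - {k}) = E - {h k}"
      using inj_on_image_set_diff[OF injh, of "{1..m}" "{k}"] k img by simp
    moreover have "h k \<in> E"
      using k img by blast
    ultimately show "free_span (A ` ({1..m} - {k})) \<noteq> ?U"
      using E unfolding imgA minimally_generates_def by simp
  next
    show "free_span (A ` {1..m}) = ?U"
      using E unfolding imgA img minimally_generates_def by simp
  qed
  moreover have "matrix_edges m u A = E"
  proof -
    have "e \<in> E" if "e \<in> edges m" "?R e \<in> ?R ` E" for e
      using inj_on_image_mem_iff[OF inj_on_edge_relation that(1)] E that(2) by blast
    then show ?thesis
      using E unfolding matrix_edges_eq imgA img by blast
  qed
  ultimately show "E \<in> relation_trees TYPE('k) m u"
    unfolding relation_trees_def by blast
qed

theorem proposition2p4: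
  fixes I :: "('n::finite, 'k::field) mpoly set"
    and m :: nat
    and u :: "nat \<Rightarrow> 'n monom_exp"
    and G :: "'n monom_exp set"
  assumes "ideal I mpoly_ring"
    and "monomial_ideal I"
    and "cohen_macaulay (mpoly_ring Quot I)"
    and "ideal_height mpoly_ring I = 2"
    and "minimal_monomial_generators I G"
    and "bij_betw u {1..m+1} G"
  shows "matroid_bases {e. e \<subseteq> {1..m+1} \<and> card e = 2} (relation_trees TYPE('k) m u)"
proof -
  let ?R = "edge_relation u :: nat set \<Rightarrow> nat \<Rightarrow>\<^sub>0 ('n, 'k) mpoly"
  let ?U = "relation_module m u :: (nat \<Rightarrow>\<^sub>0 ('n, 'k) mpoly) set"
  have homogeneous: "\<exists>d. multihomogeneous u d (?R e)" if e: "e \<in> edges m" for e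
  proof -
    obtain i j where ij: "i < j" "e = {i, j}"
      using e unfolding edges_iff by blast
    then have R: "?R e = taylor_relation u i j"
      by (simp add: edge_relation_pair)
    show ?thesis
      unfolding R by (rule taylor_relation_multihomogeneous) (use ij in simp)
  qed
  have saturated: "?R e \<in> free_span (?R ` Y)"
    if Y: "Y \<subseteq> edges m" and e: "e \<in> edges m" and c: "Poly_Mapping.lookup c 0 \<noteq> 0"
      and mem: "fscale c (?R e) \<in> free_span (?R ` Y)" for Y e c
  proof -
    obtain d where d: "multihomogeneous u d (?R e)"
      using homogeneous[OF e] by blast
    have "\<exists>d. multihomogeneous u d x" if "x \<in> ?R ` Y" for x
      using that Y homogeneous by (metis imageE subsetD)
    then show ?thesis
      using d c mem by (rule multihomogeneous_saturated)
  qed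
  interpret family: saturated_family fscale "\<lambda>p :: ('n, 'k) mpoly. Poly_Mapping.lookup p 0" ?R "edges m"
  proof
    fix Y e c
    assume "Y \<subseteq> edges m" "e \<in> edges m" "Poly_Mapping.lookup c 0 \<noteq> 0"
      "fscale c (?R e) \<in> Modules.module.span fscale (?R ` Y)"
    then show "?R e \<in> Modules.module.span fscale (?R ` Y)"
      using saturated unfolding free_span_def by blast
  qed (simp_all add: lookup_add lookup_mult_zero)
  have exchange: "\<exists>f\<in>B2 - B1. (B1 - {e}) \<union> {f} \<in> relation_trees TYPE('k) m u"
    if B1: "B1 \<in> relation_trees TYPE('k) m u" and B2: "B2 \<in> relation_trees TYPE('k) m u"
      and e: "e \<in> B1 - B2" for B1 B2 e
  proof -
    have "\<exists>f\<in>B2 - B1. minimally_generates free_span ?R ((B1 - {e}) \<union> {f}) ?U"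
      using family.minimally_generates_exchange[folded free_span_def, of B1 ?U B2 e] B1 B2 e
      unfolding relation_trees_iff by blast
    then obtain f where f: "f \<in> B2 - B1"
      and gen: "minimally_generates free_span ?R ((B1 - {e}) \<union> {f}) ?U"
      by blast
    have "finite B1"
      using B1 finite_edges finite_subset unfolding relation_trees_iff by blast
    then have "card ((B1 - {e}) \<union> {f}) = card B1"
      using e f card_Suc_Diff1[of B1 e] by simp
    then have "(B1 - {e}) \<union> {f} \<in> relation_trees TYPE('k) m u"
      using B1 B2 f gen unfolding relation_trees_iff by blast
    with f show ?thesis
      by blast
  qed
  have "matroid_bases (edges m) (relation_trees TYPE('k) m u)"
    unfolding matroid_bases_def
  proof (intro conjI ballI)
    show "finite (edges m)"
      by (rule finite_edges)
  next
    fix B assume "B \<in> relation_trees TYPE('k) m u"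
    then show "B \<subseteq> edges m"
      by (simp add: relation_trees_iff)
  next
    fix B1 B2 assume "B1 \<in> relation_trees TYPE('k) m u" "B2 \<in> relation_trees TYPE('k) m u"
    then show "card B1 = card B2"
      by (simp add: relation_trees_iff)
  qed (rule exchange)
  then show ?thesis
    by (simp add: edges_def)
qed

end
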